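(* Let $\mathcal{H}$ be a complex Hilbert space, let $A,X,B\in\mathcal{B}(\mathcal{H})$ with $X$ positive, and let $\lambda\in\mathbb{C}$. Then $$r_\omega(AXB)\le\|X\|\left[\frac{\max\{|\lambda|,|1-\lambda|\}}{2}\,\big\|\,|A^*|^2+|B|^2\,\big\|+|\lambda|\,r_\omega(AB)\right]$$ and $$r_\omega(AXB)\le\|X\|\left[|\lambda|\,r_\omega(AB)+\frac{\max\{|\lambda|,|1-\lambda|\}}{2}\big(\|A\|\,\|B\|+\|BA\|\big)\right].$$
   Context: $\mathcal{B}(\mathcal{H})$ denotes the bounded linear operators on $\mathcal{H}$; $|S|=(S^*S)^{1/2}$; $r_\omega(S)=\sup_{\|x\|=1}|\langle Sx,x\rangle|$ is the numerical radius. An operator $X$ is positive if $X=X^*$ and $\langle Xx,x\rangle\ge0$ for all $x$. *)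

theory Defs
  imports "HOL-Analysis.Analysis"
begin

class complex_vector = real_vector +
  fixes scaleC :: "complex \<Rightarrow> 'a \<Rightarrow> 'a"  (infixr "*\<^sub>C" 75)
  assumes scaleC_add_right: "c *\<^sub>C (x + y) = c *\<^sub>C x + c *\<^sub>C y"
    and scaleC_add_left: "(c + d) *\<^sub>C x = c *\<^sub>C x + d *\<^sub>C x"
    and scaleC_scaleC: "c *\<^sub>C d *\<^sub>C x = (c * d) *\<^sub>C x"
    and scaleC_one: "1 *\<^sub>C x = x"
    and scaleR_scaleC: "r *\<^sub>R x = complex_of_real r *\<^sub>C x"

text \<open>The inner product is linear in its first argument. The axiom \<open>cinner_self\<close> says that
  the inner product is positive definite and induces the given norm.\<close>

class complex_inner = complex_vector + real_normed_vector +
  fixes cinner :: "'a \<Rightarrow> 'a \<Rightarrow> complex"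
  assumes cinner_commute: "cinner x y = cnj (cinner y x)"
    and cinner_add_left: "cinner (x + y) z = cinner x z + cinner y z"
    and cinner_scaleC_left: "cinner (c *\<^sub>C x) y = c * cinner x y"
    and cinner_self: "cinner x x = complex_of_real ((norm x)\<^sup>2)"

class chilbert_space = complex_inner + complete_space

instantiation complex :: chilbert_space
begin

definition scaleC_complex :: "complex \<Rightarrow> complex \<Rightarrow> complex"
  where "scaleC_complex c x = c * x"

definition cinner_complex :: "complex \<Rightarrow> complex \<Rightarrow> complex"
  where "cinner_complex x y = x * cnj y"

instance
  by standard
    (simp_all add: scaleC_complex_def cinner_complex_def algebra_simps scaleR_conv_of_real
      complex_norm_square del: of_real_power)

end

definition bounded_clinear :: "('a::complex_inner \<Rightarrow> 'a) \<Rightarrow> bool"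
  where "bounded_clinear S \<longleftrightarrow>
    bounded_linear S \<and> (\<forall>c x. S (c *\<^sub>C x) = c *\<^sub>C S x)"

text \<open>For bounded \<open>S\<close> on a Hilbert space the adjoint exists and is unique.\<close>

definition cadjoint :: "('a::chilbert_space \<Rightarrow> 'a) \<Rightarrow> 'a \<Rightarrow> 'a"
  where "cadjoint S =
    (SOME T. bounded_clinear T \<and> (\<forall>x y. cinner (S x) y = cinner x (T y)))"

definition positive_op :: "('a::chilbert_space \<Rightarrow> 'a) \<Rightarrow> bool"
  where "positive_op S \<longleftrightarrow>
    bounded_clinear S \<and> S = cadjoint S \<and> (\<forall>x. cinner (S x) x \<in> \<real>\<^sub>\<ge>\<^sub>0)"

text \<open>For positive \<open>S\<close> the positive square root exists and is unique.\<close>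

definition sqrt_op :: "('a::chilbert_space \<Rightarrow> 'a) \<Rightarrow> 'a \<Rightarrow> 'a"
  where "sqrt_op S = (SOME R. positive_op R \<and> R \<circ> R = S)"

definition abs_op :: "('a::chilbert_space \<Rightarrow> 'a) \<Rightarrow> 'a \<Rightarrow> 'a"
  where "abs_op S = sqrt_op (cadjoint S \<circ> S)"

text \<open>The supremum is taken in the nonnegative reals: inserting \<open>0\<close> only matters on the zero
  space, which has no unit vectors.\<close>

definition numerical_radius :: "('a::chilbert_space \<Rightarrow> 'a) \<Rightarrow> real"
  where "numerical_radius S = Sup (insert 0 {cmod (cinner (S x) x) |x. norm x = 1})"

end

theory Submission
  imports Defs
begin

text \<open>Write \<open>\<langle>AXBx, x\<rangle> = \<langle>Xu, v\<rangle>\<close> with \<open>u = Bx\<close> and \<open>v = A\<^sup>*x\<close>, and put \<open>k = \<parallel>X\<parallel>\<close>. Positivity gives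
  \<open>X\<^sup>2 \<le> kX\<close>, so \<open>\<parallel>(X - k\<lambda>)u\<parallel>\<^sup>2\<close> is bounded by an affine function of \<open>\<langle>Xu, u\<rangle> \<in> [0, k\<parallel>u\<parallel>\<^sup>2]\<close> whose
  values at the endpoints are \<open>k\<^sup>2|\<lambda>|\<^sup>2\<parallel>u\<parallel>\<^sup>2\<close> and \<open>k\<^sup>2|1 - \<lambda>|\<^sup>2\<parallel>u\<parallel>\<^sup>2\<close>. Splitting \<open>X = (X - k\<lambda>) + k\<lambda>\<close> yields
  \<open>|\<langle>Xu, v\<rangle>| \<le> k (max(|\<lambda>|, |1 - \<lambda>|) \<parallel>u\<parallel>\<parallel>v\<parallel> + |\<lambda>||\<langle>u, v\<rangle>|)\<close>, and \<open>\<langle>u, v\<rangle> = \<langle>ABx, x\<rangle>\<close>. It remains to bound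
  \<open>\<parallel>Bx\<parallel>\<parallel>A\<^sup>*x\<parallel>\<close> for unit \<open>x\<close>. By AM-GM it is at most half of \<open>\<langle>(AA\<^sup>* + B\<^sup>*B)x, x\<rangle>\<close>. For the second
  bound, if \<open>\<parallel>A\<parallel> = \<parallel>B\<parallel> = m\<close> then \<open>s = \<parallel>A\<^sup>*x\<parallel>\<^sup>2 + \<parallel>Bx\<parallel>\<^sup>2\<close> satisfies
  \<open>s\<^sup>2 \<le> \<parallel>AA\<^sup>*x + B\<^sup>*Bx\<parallel>\<^sup>2 \<le> (m\<^sup>2 + \<parallel>BA\<parallel>) s\<close>.\<close>

instance chilbert_space \<subseteq> banach ..

section \<open>The complex inner product\<close>

lemma cinner_add_right: "cinner x (y + z) = cinner x y + cinner x (z::'a::complex_inner)"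
  by (simp add: cinner_add_left cinner_commute[of x])

lemma cinner_scaleC_right: "cinner x (c *\<^sub>C y) = cnj c * cinner x (y::'a::complex_inner)"
  by (simp add: cinner_scaleC_left cinner_commute[of x])

lemma cinner_scaleR_left: "cinner (r *\<^sub>R x) y = of_real r * cinner x (y::'a::complex_inner)"
  by (simp add: scaleR_scaleC cinner_scaleC_left)

lemma cinner_scaleR_right: "cinner x (r *\<^sub>R y) = of_real r * cinner x (y::'a::complex_inner)"
  by (simp add: scaleR_scaleC cinner_scaleC_right)

lemma cinner_minus_left: "cinner (- x) y = - cinner x (y::'a::complex_inner)"
  using cinner_scaleR_left[of "-1" x y] by simp

lemma cinner_minus_right: "cinner x (- y) = - cinner x (y::'a::complex_inner)"
  using cinner_scaleR_right[of x "-1" y] by simp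

lemma cinner_diff_left: "cinner (x - y) z = cinner x z - cinner y (z::'a::complex_inner)"
  using cinner_add_left[of x "- y" z] by (simp add: cinner_minus_left)

lemma cinner_diff_right: "cinner x (y - z) = cinner x y - cinner x (z::'a::complex_inner)"
  using cinner_add_right[of x y "- z"] by (simp add: cinner_minus_right)

lemmas cinner_simps = cinner_add_left cinner_add_right cinner_diff_left cinner_diff_right
  cinner_minus_left cinner_minus_right cinner_scaleR_left cinner_scaleR_right
  cinner_scaleC_left cinner_scaleC_right

lemma Re_cinner_commute: "Re (cinner y x) = Re (cinner x (y::'a::complex_inner))"
  by (simp add: cinner_commute[of y x])

lemma norm_power2_eq_cinner: "(norm x)\<^sup>2 = Re (cinner x (x::'a::complex_inner))"
  by (simp add: cinner_self del: of_real_power)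

lemma norm_add_power2:
  "(norm (x + y))\<^sup>2 = (norm x)\<^sup>2 + 2 * Re (cinner x y) + (norm (y::'a::complex_inner))\<^sup>2"
  by (simp add: norm_power2_eq_cinner cinner_simps Re_cinner_commute[of y x])

lemma norm_diff_power2:
  "(norm (x - y))\<^sup>2 = (norm x)\<^sup>2 - 2 * Re (cinner x y) + (norm (y::'a::complex_inner))\<^sup>2"
  by (simp add: norm_power2_eq_cinner cinner_simps Re_cinner_commute[of y x])

lemma cinner_eqI:
  assumes "\<And>z. cinner z x = cinner z (y::'a::complex_inner)"
  shows "x = y"
proof -
  have "cinner (x - y) (x - y) = 0"
    using assms[of "x - y"] by (simp add: cinner_diff_right)
  then show ?thesis by (simp add: cinner_self)
qed

lemma norm_scaleC: "norm (c *\<^sub>C x) = cmod c * norm (x::'a::complex_inner)"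
proof -
  have "complex_of_real ((norm (c *\<^sub>C x))\<^sup>2) = (c * cnj c) * cinner x x"
    unfolding cinner_self[symmetric] by (simp add: cinner_simps)
  also have "\<dots> = complex_of_real ((cmod c * norm x)\<^sup>2)"
    using complex_norm_square[of c] by (simp add: cinner_self power_mult_distrib)
  finally have "complex_of_real ((norm (c *\<^sub>C x))\<^sup>2) = complex_of_real ((cmod c * norm x)\<^sup>2)" .
  then have "(norm (c *\<^sub>C x))\<^sup>2 = (cmod c * norm x)\<^sup>2"
    by (simp only: of_real_eq_iff)
  then show ?thesis
    by (simp add: power2_eq_iff_nonneg)
qed

text \<open>Expanding the squared norm of \<open>norm y *\<^sub>R x - norm x *\<^sub>R y\<close>
  leaves the gap of the inequality times a factor that is positive for nonzero vectors.\<close>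

lemma Re_cinner_le: "Re (cinner x y) \<le> norm x * norm (y::'a::complex_inner)"
proof (cases "x = 0 \<or> y = 0")
  case True
  then show ?thesis
    using cinner_scaleR_left[of 0 x y] cinner_scaleR_right[of x 0 y] by auto
next
  case False
  have "0 \<le> (norm (norm y *\<^sub>R x - norm x *\<^sub>R y))\<^sup>2" by simp
  also have "\<dots> = 2 * (norm x * norm y) * (norm x * norm y - Re (cinner x y))"
    unfolding norm_diff_power2
    by (simp add: cinner_simps power_mult_distrib) (simp add: algebra_simps power2_eq_square)
  finally show ?thesis using False by (auto simp: zero_le_mult_iff mult_le_0_iff)
qed

text \<open>Multiplying \<open>x\<close> by a unimodular scalar makes the inner product real and
  nonnegative without changing \<open>norm x\<close>, which reduces the claim to the real
  part.\<close>

lemma cmod_cinner_le: "cmod (cinner x y) \<le> norm x * norm (y::'a::complex_inner)"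
proof (cases "cinner x y = 0")
  case False
  define c where "c = cnj (cinner x y) / cmod (cinner x y)"
  have c: "cmod c = 1" using False by (simp add: c_def norm_divide)
  have "c * cinner x y = cmod (cinner x y)"
    using False complex_norm_square[of "cinner x y"]
    by (simp add: c_def divide_eq_eq power2_eq_square mult.commute)
  then have "cmod (cinner x y) = Re (cinner (c *\<^sub>C x) y)"
    by (simp add: cinner_simps)
  also have "\<dots> \<le> norm (c *\<^sub>C x) * norm y" by (rule Re_cinner_le)
  finally show ?thesis by (simp add: norm_scaleC c)
qed simp

lemma bounded_bilinear_cinner:
  "bounded_bilinear (cinner :: 'a::complex_inner \<Rightarrow> 'a \<Rightarrow> complex)"
proof
  show "\<exists>K. \<forall>x y :: 'a. norm (cinner x y) \<le> norm x * norm y * K"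
    using cmod_cinner_le by (intro exI[of _ 1]) auto
qed (simp_all add: cinner_simps scaleR_conv_of_real)

lemmas tendsto_cinner = bounded_bilinear.tendsto[OF bounded_bilinear_cinner]

section \<open>Riesz representation and adjoints\<close>

lemma Riesz_real:
  fixes g :: "'a::chilbert_space \<Rightarrow> real"
  assumes "bounded_linear g"
  shows "\<exists>z. \<forall>y. g y = Re (cinner y z)"
proof -
  interpret g: bounded_linear g by fact
  text \<open>The representing vector is the minimiser of \<open>J\<close>; by the parallelogram law every minimising
    sequence is Cauchy.\<close>
  define J where "J x = (norm x)\<^sup>2 - 2 * g x" for x
  obtain K where K: "\<And>x. norm (g x) \<le> norm x * K" and "K > 0"
    using g.pos_bounded by blast
  have J_lower: "J x \<ge> - K\<^sup>2" for x
  proof -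
    have "g x \<le> norm x * K" using K[of x] by simp
    moreover have "0 \<le> (norm x - K)\<^sup>2" by simp
    ultimately show ?thesis by (simp add: J_def power2_diff)
  qed
  then have bdd: "bdd_below (range J)" by (auto intro!: bdd_belowI)
  define m where "m = Inf (range J)"
  have m_le: "m \<le> J x" for x unfolding m_def by (rule cInf_lower[OF _ bdd]) simp
  have "\<exists>x. J x < m + inverse (real (Suc n))" for n
    using cInf_lessD[of "range J" "m + inverse (real (Suc n))"] unfolding m_def[symmetric]
    by auto
  then obtain x where x: "\<And>n. J (x n) < m + inverse (real (Suc n))" by metis
  have par: "(norm (a - b))\<^sup>2 = 2 * J a + 2 * J b - 4 * J ((1/2) *\<^sub>R (a + b))" for a b
  proof -
    have "(norm (a - b))\<^sup>2 + (norm (a + b))\<^sup>2 = 2 * (norm a)\<^sup>2 + 2 * (norm b)\<^sup>2"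
      by (simp add: norm_add_power2 norm_diff_power2)
    moreover have "J ((1/2) *\<^sub>R (a + b)) = (norm (a + b))\<^sup>2 / 4 - g a - g b"
      by (simp only: J_def g.scaleR g.add norm_scaleR power_mult_distrib)
        (simp add: power_divide add_divide_distrib)
    ultimately show ?thesis by (simp add: J_def)
  qed
  have "Cauchy x"
  proof (rule metric_CauchyI)
    fix e :: real assume "e > 0"
    \<comment> \<open>By \<open>par\<close>, two values of \<open>J\<close> within e^2/4 of the
      infimum, with the midpoint value at least \<open>m\<close>, give a squared distance below 4 *
      (e^2/4).\<close>
    then obtain N where N: "inverse (real (Suc N)) < e\<^sup>2 / 4"
      using reals_Archimedean[of "e\<^sup>2 / 4"] by auto
    have near: "J (x k) < m + e\<^sup>2 / 4" if "k \<ge> N" for k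
    proof -
      have "inverse (real (Suc k)) \<le> inverse (real (Suc N))"
        using that by (intro le_imp_inverse_le) auto
      then show ?thesis using x[of k] N by linarith
    qed
    have "dist (x i) (x j) < e" if "i \<ge> N" "j \<ge> N" for i j
    proof -
      have "(norm (x i - x j))\<^sup>2 < e\<^sup>2"
        using par[of "x i" "x j"] near[OF that(1)] near[OF that(2)]
          m_le[of "(1/2) *\<^sub>R (x i + x j)"] by linarith
      then show ?thesis using \<open>e > 0\<close> by (simp add: dist_norm power_less_imp_less_base)
    qed
    then show "\<exists>N. \<forall>i\<ge>N. \<forall>j\<ge>N. dist (x i) (x j) < e" by blast
  qed
  then obtain z where z: "x \<longlonglongrightarrow> z" using Cauchy_convergent_iff convergent_def by blast
  have "(\<lambda>n. J (x n)) \<longlonglongrightarrow> J z" unfolding J_def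
    by (intro tendsto_intros g.tendsto z)
  moreover have "(\<lambda>n. m + inverse (real (Suc n))) \<longlonglongrightarrow> m + 0"
    by (intro tendsto_intros LIMSEQ_inverse_real_of_nat)
  ultimately have "J z \<le> m + 0"
    by (rule LIMSEQ_le) (use x less_imp_le in blast)
  then have min: "J z \<le> J w" for w using m_le[of w] by simp
  have "g y = Re (cinner y z)" for y
  proof (rule ccontr)
    define d where "d = g y - Re (cinner y z)"
    assume "g y \<noteq> Re (cinner y z)"
    then have d: "d \<noteq> 0" by (simp add: d_def)
    \<comment> \<open>This is J(z + t y) - J(z) at the minimiser \<open>z\<close>; a nonzero linear
      coefficient \<open>d\<close> would make it negative for some small \<open>t\<close>.\<close>
    have quad: "0 \<le> t\<^sup>2 * (norm y)\<^sup>2 - 2 * t * d" for t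
      using min[of "z + t *\<^sub>R y"]
      by (simp add: J_def norm_add_power2 g.add g.scaleR cinner_simps d_def power_mult_distrib
          Re_cinner_commute[of y z] algebra_simps)
    \<comment> \<open>The added 1 keeps \<open>N\<close> positive when \<open>y = 0\<close>. The
      choice t = d/N turns the quadratic into -d^2 (N + 1) / N^2.\<close>
    define N where "N = (norm y)\<^sup>2 + 1"
    have N: "N > 0" and ny: "(norm y)\<^sup>2 = N - 1" by (simp_all add: N_def add_nonneg_pos)
    have "0 \<le> N\<^sup>2 * ((d / N)\<^sup>2 * (norm y)\<^sup>2 - 2 * (d / N) * d)"
      by (intro mult_nonneg_nonneg quad) simp
    also have "\<dots> = - (d\<^sup>2 * (N + 1))"
      unfolding ny using N by (simp add: field_simps power2_eq_square)
    finally have "d\<^sup>2 * (N + 1) \<le> 0" by simp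
    moreover have "0 < d\<^sup>2 * (N + 1)" using d N by (intro mult_pos_pos) auto
    ultimately show False by linarith
  qed
  then show ?thesis by blast
qed

text \<open>A complex linear functional is determined by its real part: evaluating the real
  representation at \<open>\<i> *\<^sub>C y\<close> recovers the imaginary parts.\<close>

lemma Riesz:
  fixes f :: "'a::chilbert_space \<Rightarrow> complex"
  assumes "bounded_linear f" and scale: "\<And>c x. f (c *\<^sub>C x) = c * f x"
  shows "\<exists>z. \<forall>y. f y = cinner y z"
proof -
  have "bounded_linear (\<lambda>x. Re (f x))"
    using bounded_linear_compose[OF bounded_linear_Re assms(1)] by simp
  then obtain z where z: "\<And>y. Re (f y) = Re (cinner y z)" using Riesz_real by blast
  have "Im (f y) = Im (cinner y z)" for y
    using z[of "\<i> *\<^sub>C y"] by (simp add: scale cinner_scaleC_left)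
  with z show ?thesis by (auto simp: complex_eq_iff)
qed

text \<open>Linearity of \<open>T\<close> comes from nondegeneracy of the inner product, and
  boundedness from testing the adjoint relation at x = T y. It serves both for adjoints and, with T
  = S, for symmetric operators.\<close>

lemma bounded_clinear_of_adjoint_pair:
  fixes S T :: "'a::complex_inner \<Rightarrow> 'a"
  assumes "bounded_linear S" and adj: "\<And>x y. cinner (S x) y = cinner x (T y)"
  shows "bounded_clinear T"
proof -
  have add: "T (x + y) = T x + T y" for x y
    by (rule cinner_eqI) (simp add: cinner_simps flip: adj)
  have scale: "T (c *\<^sub>C x) = c *\<^sub>C T x" for c x
    by (rule cinner_eqI) (simp add: cinner_simps flip: adj)
  have "norm (T y) \<le> norm y * onorm S" for y
  proof (cases "T y = 0")
    case True
    then show ?thesis by (simp add: onorm_pos_le[OF assms(1)])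
  next
    case False
    have "norm (T y) * norm (T y) = Re (cinner (S (T y)) y)"
      by (simp add: adj norm_power2_eq_cinner flip: power2_eq_square)
    also have "\<dots> \<le> norm (S (T y)) * norm y" by (rule Re_cinner_le)
    also have "\<dots> \<le> (onorm S * norm (T y)) * norm y"
      by (intro mult_right_mono onorm[OF assms(1)]) simp
    finally show ?thesis using False by (simp add: mult_ac)
  qed
  then have "bounded_linear T"
    by (intro bounded_linear_intro) (auto simp: add scale scaleR_scaleC)
  with scale show ?thesis by (simp add: bounded_clinear_def)
qed

text \<open>Riesz applied to \<open>cinner (S x) y\<close> as a function of \<open>x\<close>
  produces the adjoint pointwise, which discharges the choice in \<open>cadjoint\<close>.\<close>

lemma
  fixes S :: "'a::chilbert_space \<Rightarrow> 'a"
  assumes S: "bounded_clinear S"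
  shows bounded_clinear_cadjoint: "bounded_clinear (cadjoint S)"
    and cinner_cadjoint: "cinner (S x) y = cinner x (cadjoint S y)"
proof -
  have "\<exists>z. \<forall>x. cinner (S x) y = cinner x z" for y
    using S bounded_linear_compose[OF
        bounded_bilinear.bounded_linear_left[OF bounded_bilinear_cinner, of y], of S]
    by (intro Riesz) (auto simp: bounded_clinear_def cinner_scaleC_left)
  then obtain T where T: "\<And>x y. cinner (S x) y = cinner x (T y)" by metis
  then have "bounded_clinear T"
    using S bounded_clinear_of_adjoint_pair unfolding bounded_clinear_def by blast
  with T have "\<exists>T. bounded_clinear T \<and> (\<forall>x y. cinner (S x) y = cinner x (T y))" by blast
  then have "bounded_clinear (cadjoint S) \<and> (\<forall>x y. cinner (S x) y = cinner x (cadjoint S y))"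
    unfolding cadjoint_def by (rule someI_ex)
  then show "bounded_clinear (cadjoint S)" "cinner (S x) y = cinner x (cadjoint S y)"
    by simp_all
qed

lemma cadjoint_eqI:
  fixes S :: "'a::chilbert_space \<Rightarrow> 'a"
  assumes "bounded_clinear S" and "\<And>x y. cinner (S x) y = cinner x (T y)"
  shows "cadjoint S = T"
  by (rule ext, rule cinner_eqI) (simp add: assms(2) flip: cinner_cadjoint[OF assms(1)])

lemma cinner_cadjoint_left:
  fixes S :: "'a::chilbert_space \<Rightarrow> 'a"
  assumes "bounded_clinear S"
  shows "cinner (cadjoint S x) y = cinner x (S y)"
  by (simp add: cinner_commute[of "cadjoint S x"] cinner_commute[of x] cinner_cadjoint[OF assms])

lemma cadjoint_cadjoint:
  fixes S :: "'a::chilbert_space \<Rightarrow> 'a"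
  assumes "bounded_clinear S"
  shows "cadjoint (cadjoint S) = S"
  by (rule cadjoint_eqI[OF bounded_clinear_cadjoint[OF assms] cinner_cadjoint_left[OF assms]])

lemma norm_cadjoint_le:
  fixes S :: "'a::chilbert_space \<Rightarrow> 'a"
  assumes "bounded_clinear S"
  shows "norm (cadjoint S y) \<le> onorm S * norm y"
proof (cases "cadjoint S y = 0")
  case True
  then show ?thesis using assms by (simp add: onorm_pos_le bounded_clinear_def)
next
  case False
  let ?z = "cadjoint S y"
  have "norm ?z * norm ?z = Re (cinner (S ?z) y)"
    by (simp add: cinner_cadjoint[OF assms] norm_power2_eq_cinner flip: power2_eq_square)
  also have "\<dots> \<le> norm (S ?z) * norm y" by (rule Re_cinner_le)
  also have "\<dots> \<le> (onorm S * norm ?z) * norm y"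
    using assms by (intro mult_right_mono onorm) (auto simp: bounded_clinear_def)
  finally show ?thesis using False by (simp add: mult_ac)
qed

section \<open>Square roots\<close>

text \<open>The iteration solves \<open>L = (T + L\<^sup>2) / 2\<close>, that is \<open>(1 - L)\<^sup>2 = 1 - T\<close>. Its increments are
  dominated by those of the scalar iteration with \<open>T = 1\<close>, so it converges in operator norm.\<close>

primrec sqrt_iter :: "('a::real_normed_vector \<Rightarrow>\<^sub>L 'a) \<Rightarrow> nat \<Rightarrow> ('a \<Rightarrow>\<^sub>L 'a)" where
  "sqrt_iter T 0 = 0"
| "sqrt_iter T (Suc n) = (1/2) *\<^sub>R (T + (sqrt_iter T n o\<^sub>L sqrt_iter T n))"

primrec scalar_sqrt_iter :: "nat \<Rightarrow> real" where
  "scalar_sqrt_iter 0 = 0"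
| "scalar_sqrt_iter (Suc n) = (1 + (scalar_sqrt_iter n)\<^sup>2) / 2"

lemma scalar_sqrt_iter_bounds: "0 \<le> scalar_sqrt_iter n \<and> scalar_sqrt_iter n \<le> 1"
  by (induction n) (auto simp: power_le_one)

lemma scalar_sqrt_iter_mono: "scalar_sqrt_iter n \<le> scalar_sqrt_iter (Suc n)"
proof -
  have "0 \<le> (1 - scalar_sqrt_iter n)\<^sup>2" by simp
  then show ?thesis by (simp add: power2_diff)
qed

lemma norm_sqrt_iter_le:
  assumes "norm T \<le> 1"
  shows "norm (sqrt_iter T n) \<le> scalar_sqrt_iter n"
proof (induction n)
  case (Suc n)
  let ?Y = "sqrt_iter T n"
  have "norm (?Y o\<^sub>L ?Y) \<le> norm ?Y * norm ?Y" by (rule norm_blinfun_compose)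
  also have "\<dots> \<le> scalar_sqrt_iter n * scalar_sqrt_iter n"
    using Suc scalar_sqrt_iter_bounds[of n] by (intro mult_mono) auto
  finally show ?case
    using norm_triangle_ineq[of T "?Y o\<^sub>L ?Y"] assms by (simp add: power2_eq_square)
qed simp

text \<open>The factorisation of Z^2 - Y^2 below avoids commuting \<open>Y\<close> and
  \<open>Z\<close>, and its norm bound z (z - y) + (z - y) y is exactly the scalar increment z^2 -
  y^2.\<close>

lemma norm_sqrt_iter_diff_le:
  assumes "norm T \<le> 1"
  shows "norm (sqrt_iter T (Suc n) - sqrt_iter T n)
    \<le> scalar_sqrt_iter (Suc n) - scalar_sqrt_iter n"
proof (induction n)
  case 0
  then show ?case using assms by simp
next
  case (Suc n)
  define Y Z where "Y = sqrt_iter T n" and "Z = sqrt_iter T (Suc n)"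
  define y z where "y = scalar_sqrt_iter n" and "z = scalar_sqrt_iter (Suc n)"
  have IH: "norm (Z - Y) \<le> z - y" using Suc by (simp only: Y_def Z_def y_def z_def)
  have Y: "norm Y \<le> y" and Z: "norm Z \<le> z"
    unfolding Y_def Z_def y_def z_def by (intro norm_sqrt_iter_le assms)+
  have "(Z o\<^sub>L Z) - (Y o\<^sub>L Y) = (Z o\<^sub>L (Z - Y)) + ((Z - Y) o\<^sub>L Y)"
    by (rule blinfun_eqI) (simp add: blinfun.bilinear_simps)
  then have "norm ((Z o\<^sub>L Z) - (Y o\<^sub>L Y)) \<le> norm (Z o\<^sub>L (Z - Y)) + norm ((Z - Y) o\<^sub>L Y)"
    by (simp add: norm_triangle_ineq)
  also have "\<dots> \<le> norm Z * norm (Z - Y) + norm (Z - Y) * norm Y"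
    by (intro add_mono norm_blinfun_compose)
  also have "\<dots> \<le> z * (z - y) + (z - y) * y"
    by (intro add_mono mult_mono IH Y Z order_trans[OF norm_ge_zero Z]
        order_trans[OF norm_ge_zero IH]) auto
  also have "\<dots> = z\<^sup>2 - y\<^sup>2" by (simp add: algebra_simps power2_eq_square)
  finally have main: "norm ((Z o\<^sub>L Z) - (Y o\<^sub>L Y)) \<le> z\<^sup>2 - y\<^sup>2" .
  have "sqrt_iter T (Suc (Suc n)) - sqrt_iter T (Suc n) = (1/2) *\<^sub>R ((Z o\<^sub>L Z) - (Y o\<^sub>L Y))"
    by (simp add: Y_def Z_def scaleR_diff_right scaleR_add_right)
  moreover have "scalar_sqrt_iter (Suc (Suc n)) - scalar_sqrt_iter (Suc n) = (z\<^sup>2 - y\<^sup>2) / 2"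
    by (simp add: y_def z_def diff_divide_distrib add_divide_distrib)
  ultimately show ?case using main by simp
qed

text \<open>The scalar sequence is increasing and bounded, so its telescoping series converges and
  dominates the increments; completeness of the operator space does the rest.\<close>

lemma convergent_sqrt_iter:
  fixes T :: "'a::banach \<Rightarrow>\<^sub>L 'a"
  assumes "norm T \<le> 1"
  shows "convergent (sqrt_iter T)"
proof -
  have "incseq scalar_sqrt_iter" by (rule incseq_SucI) (rule scalar_sqrt_iter_mono)
  then obtain l where "scalar_sqrt_iter \<longlonglongrightarrow> l"
    using incseq_convergent[of scalar_sqrt_iter 1] scalar_sqrt_iter_bounds by blast
  then have "summable (\<lambda>n. scalar_sqrt_iter (Suc n) - scalar_sqrt_iter n)"
    by (rule telescope_summable)
  then have "summable (\<lambda>n. sqrt_iter T (Suc n) - sqrt_iter T n)"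
    by (rule summable_comparison_test'[where N = 0]) (rule norm_sqrt_iter_diff_le[OF assms])
  then show ?thesis by (simp only: summable_iff_convergent sum_lessThan_telescope) simp
qed

lemma cinner_sqrt_iter:
  fixes T :: "'a::complex_inner \<Rightarrow>\<^sub>L 'a"
  assumes "\<And>x y. cinner (T x) y = cinner x (T y)"
  shows "cinner (sqrt_iter T n x) y = cinner x (sqrt_iter T n y)"
proof (induction n arbitrary: x y)
  case 0
  then show ?case
    using cinner_scaleR_left[of 0 0 y] cinner_scaleR_right[of x 0 0] by simp
next
  case (Suc n)
  then show ?case by (simp add: blinfun.bilinear_simps cinner_simps assms)
qed

section \<open>Positive operators and existence of positive roots\<close>

text \<open>Symmetry alone yields complex linearity through the adjoint pair, and forces the
  quadratic form to be real, so only its real part has to be checked.\<close>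

lemma positive_opI:
  fixes R :: "'a::chilbert_space \<Rightarrow> 'a"
  assumes "bounded_linear R" and sym: "\<And>x y. cinner (R x) y = cinner x (R y)"
    and "\<And>x. 0 \<le> Re (cinner (R x) x)"
  shows "positive_op R"
proof -
  have "bounded_clinear R"
    by (rule bounded_clinear_of_adjoint_pair[OF assms(1) sym])
  moreover have "cinner (R x) x \<in> \<real>\<^sub>\<ge>\<^sub>0" for x
  proof -
    have "cnj (cinner (R x) x) = cinner (R x) x"
      using sym[of x x] cinner_commute[of x "R x"] by simp
    then have "Im (cinner (R x) x) = 0" by (metis Reals_cnj_iff complex_is_Real_iff)
    with assms(3) show ?thesis by (simp add: complex_nonneg_Reals_iff)
  qed
  ultimately show ?thesis
    using sym by (simp add: positive_op_def cadjoint_eqI)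
qed

lemma positive_opD:
  fixes S :: "'a::chilbert_space \<Rightarrow> 'a"
  assumes "positive_op S"
  shows "bounded_clinear S" and "bounded_linear S" and "cadjoint S = S"
    and "cinner (S x) x = of_real (Re (cinner (S x) x))" and "0 \<le> Re (cinner (S x) x)"
proof -
  from assms have *: "bounded_clinear S" "S = cadjoint S" "cinner (S x) x \<in> \<real>\<^sub>\<ge>\<^sub>0"
    unfolding positive_op_def by blast+
  show "bounded_clinear S" "cadjoint S = S" by (fact *, fact *(2)[symmetric])
  show "bounded_linear S" using *(1) by (simp add: bounded_clinear_def)
  show "cinner (S x) x = of_real (Re (cinner (S x) x))" "0 \<le> Re (cinner (S x) x)"
    using *(3) by (simp_all add: complex_nonneg_Reals_iff complex_eq_iff)
qed

text \<open>The root is 1 - L for the limit \<open>L\<close> of the iteration. Symmetry of the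
  iterates passes to \<open>L\<close>, and positivity of 1 - L follows from
  \<open>norm L \<le> 1\<close>.\<close>

lemma ex_positive_sqrt_one_minus:
  fixes T :: "'a::chilbert_space \<Rightarrow>\<^sub>L 'a"
  assumes T: "norm T \<le> 1" and sym: "\<And>x y. cinner (T x) y = cinner x (T y)"
  shows "\<exists>R. positive_op R \<and> (\<forall>x. R (R x) = x - T x)"
proof -
  obtain L where L: "sqrt_iter T \<longlonglongrightarrow> L"
    using convergent_sqrt_iter[OF T] by (auto simp: convergent_def)
  have "(\<lambda>n. sqrt_iter T (Suc n)) \<longlonglongrightarrow> (1/2) *\<^sub>R (T + (L o\<^sub>L L))"
    unfolding sqrt_iter.simps
    by (intro tendsto_intros bounded_bilinear.tendsto[OF bounded_bilinear_blinfun_compose] L)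
  moreover have "(\<lambda>n. sqrt_iter T (Suc n)) \<longlonglongrightarrow> L" using L by (rule LIMSEQ_Suc)
  ultimately have fix_eq: "L = (1/2) *\<^sub>R (T + (L o\<^sub>L L))" by (rule LIMSEQ_unique[symmetric])
  have LL: "L (L x) = 2 *\<^sub>R L x - T x" for x
  proof -
    have "2 *\<^sub>R L = T + (L o\<^sub>L L)" using arg_cong[OF fix_eq, of "\<lambda>Z. 2 *\<^sub>R Z"] by simp
    then have "(2 *\<^sub>R L) x = (T + (L o\<^sub>L L)) x" by (rule arg_cong)
    then show ?thesis by (simp add: blinfun.bilinear_simps eq_diff_eq add.commute)
  qed
  have "norm (sqrt_iter T n) \<le> 1" for n
    using norm_sqrt_iter_le[OF T, of n] scalar_sqrt_iter_bounds[of n] by linarith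
  then have L1: "norm L \<le> 1"
    by (intro LIMSEQ_le_const2[OF tendsto_norm[OF L]]) auto
  have symL: "cinner (L x) y = cinner x (L y)" for x y
  proof (rule LIMSEQ_unique)
    show "(\<lambda>n. cinner (sqrt_iter T n x) y) \<longlonglongrightarrow> cinner (L x) y"
      by (intro tendsto_cinner blinfun.tendsto L tendsto_const)
    show "(\<lambda>n. cinner (sqrt_iter T n x) y) \<longlonglongrightarrow> cinner x (L y)"
      unfolding cinner_sqrt_iter[OF sym]
      by (intro tendsto_cinner blinfun.tendsto L tendsto_const)
  qed
  define R where "R x = x - L x" for x
  have "positive_op R"
  proof (rule positive_opI)
    show "bounded_linear R" unfolding R_def
      by (intro bounded_linear_intros blinfun.bounded_linear_right)
    show "cinner (R x) y = cinner x (R y)" for x y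
      by (simp add: R_def cinner_simps symL)
    show "0 \<le> Re (cinner (R x) x)" for x
    proof -
      have "Re (cinner (L x) x) \<le> norm (L x) * norm x" by (rule Re_cinner_le)
      also have "\<dots> \<le> (norm L * norm x) * norm x"
        by (intro mult_right_mono norm_blinfun) simp
      also have "\<dots> \<le> (1 * norm x) * norm x" by (intro mult_right_mono L1) auto
      finally show ?thesis
        by (simp add: R_def cinner_simps flip: norm_power2_eq_cinner power2_eq_square)
    qed
  qed
  moreover have "R (R x) = x - T x" for x
    by (simp add: R_def blinfun.bilinear_simps LL scaleR_2)
  ultimately show ?thesis by blast
qed

text \<open>Dividing \<open>cadjoint B \<circ> B\<close> by the square of the norm of
  \<open>B\<close> puts it in the form 1 - T with a symmetric contraction \<open>T\<close>; the root
  obtained is then multiplied by that norm.\<close>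

lemma ex_positive_sqrt_cadjoint_comp:
  fixes B :: "'a::chilbert_space \<Rightarrow> 'a"
  assumes B: "bounded_clinear B"
  shows "\<exists>R. positive_op R \<and> R \<circ> R = cadjoint B \<circ> B"
proof -
  let ?B' = "cadjoint B"
  have bl: "bounded_linear B" "bounded_linear ?B'"
    using B bounded_clinear_cadjoint[OF B] by (auto simp: bounded_clinear_def)
  define \<beta> where "\<beta> = onorm B"
  have \<beta>: "0 \<le> \<beta>" by (simp add: \<beta>_def onorm_pos_le bl)
  \<comment> \<open>For \<open>\<beta> = 0\<close> division by zero gives \<open>c = 0\<close> and
    \<open>T\<close> is the identity; this is consistent because \<open>B\<close> then
    vanishes.\<close>
  define c where "c = 1 / \<beta>\<^sup>2"
  have "bounded_linear (\<lambda>x. x - c *\<^sub>R ?B' (B x))"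
    by (intro bounded_linear_intros bounded_linear_compose[OF bl(2)] bl(1))
  then obtain T where T: "\<And>x. blinfun_apply T x = x - c *\<^sub>R ?B' (B x)"
    by (intro that[of "Blinfun (\<lambda>x. x - c *\<^sub>R ?B' (B x))"]) (simp add: bounded_linear_Blinfun_apply)
  have scale: "\<beta>\<^sup>2 *\<^sub>R (c *\<^sub>R ?B' (B x)) = ?B' (B x)" for x
  proof (cases "\<beta> = 0")
    case True
    then have "B x = 0" using onorm[OF bl(1), of x] by (simp add: \<beta>_def)
    then show ?thesis by (simp add: linear_0 bounded_linear.linear[OF bl(2)])
  qed (simp add: c_def)
  have "norm (T x) \<le> 1 * norm x" for x
  proof (cases "\<beta> = 0")
    case True
    then show ?thesis by (simp add: T c_def)
  next
    case False
    \<comment> \<open>Since c^2 \<beta>^2 = c, the quadratic term in the expansion of the squared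
      norm of \<open>T x\<close> is absorbed by half of the cross term.\<close>
    have "(norm (?B' (B x)))\<^sup>2 \<le> (\<beta> * norm (B x))\<^sup>2"
      unfolding \<beta>_def by (intro power_mono norm_cadjoint_le B) simp
    then have "c\<^sup>2 * (norm (?B' (B x)))\<^sup>2 \<le> c\<^sup>2 * (\<beta> * norm (B x))\<^sup>2"
      by (intro mult_left_mono) simp_all
    also have "\<dots> = c * (norm (B x))\<^sup>2"
      using False by (simp add: c_def power2_eq_square)
    finally have *: "c\<^sup>2 * (norm (?B' (B x)))\<^sup>2 \<le> c * (norm (B x))\<^sup>2" .
    have "(norm (T x))\<^sup>2 = (norm x)\<^sup>2 - 2 * c * (norm (B x))\<^sup>2 + c\<^sup>2 * (norm (?B' (B x)))\<^sup>2"
      unfolding T norm_diff_power2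
      by (simp add: cinner_simps power_mult_distrib norm_power2_eq_cinner[of "B x"]
          flip: cinner_cadjoint[OF B])
    also have "\<dots> \<le> (norm x)\<^sup>2"
    proof -
      have "0 \<le> c * (norm (B x))\<^sup>2" by (simp add: c_def)
      with * show ?thesis by linarith
    qed
    finally have "norm (T x) \<le> norm x" by (rule power2_le_imp_le) simp
    then show ?thesis by simp
  qed
  then have "norm T \<le> 1" by (intro norm_blinfun_bound) auto
  moreover have "cinner (T x) y = cinner x (T y)" for x y
    by (simp add: T cinner_simps cinner_cadjoint_left[OF B] flip: cinner_cadjoint[OF B])
  ultimately obtain R where R: "positive_op R" "\<And>x. R (R x) = x - T x"
    using ex_positive_sqrt_one_minus by blast
  note R_pos = positive_opD[OF R(1)]
  have "positive_op (\<lambda>x. \<beta> *\<^sub>R R x)"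
  proof (rule positive_opI)
    show "bounded_linear (\<lambda>x. \<beta> *\<^sub>R R x)"
      by (intro bounded_linear_intros R_pos)
    show "cinner (\<beta> *\<^sub>R R x) y = cinner x (\<beta> *\<^sub>R R y)" for x y
      using cinner_cadjoint[OF R_pos(1), of x y] by (simp add: cinner_simps R_pos(3))
    show "0 \<le> Re (cinner (\<beta> *\<^sub>R R x) x)" for x
      using R_pos(5)[of x] \<beta> by (simp add: cinner_simps)
  qed
  moreover have "(\<lambda>x. \<beta> *\<^sub>R R x) \<circ> (\<lambda>x. \<beta> *\<^sub>R R x) = cadjoint B \<circ> B"
  proof
    fix x
    show "((\<lambda>x. \<beta> *\<^sub>R R x) \<circ> (\<lambda>x. \<beta> *\<^sub>R R x)) x = (cadjoint B \<circ> B) x"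
      using scale[of x]
      by (simp add: linear_scale[OF bounded_linear.linear[OF R_pos(2)]] R(2) T
          power2_eq_square mult.assoc)
  qed
  ultimately show ?thesis by blast
qed

text \<open>The existence of a root discharges the choice in \<open>sqrt_op\<close>; every later use
  of \<open>abs_op\<close> goes through this identity.\<close>

lemma abs_op_power2:
  fixes B :: "'a::chilbert_space \<Rightarrow> 'a"
  assumes "bounded_clinear B"
  shows "abs_op B ^^ 2 = cadjoint B \<circ> B"
  using someI_ex[OF ex_positive_sqrt_cadjoint_comp[OF assms]]
  by (simp add: abs_op_def sqrt_op_def numeral_2_eq_2)

section \<open>Numerical radius\<close>

lemma
  fixes S :: "'a::chilbert_space \<Rightarrow> 'a"
  assumes "bounded_linear S"
  shows numerical_radius_nonneg: "0 \<le> numerical_radius S"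
    and numerical_radius_upper: "norm x = 1 \<Longrightarrow> cmod (cinner (S x) x) \<le> numerical_radius S"
proof -
  have "cmod (cinner (S x) x) \<le> onorm S" if "norm x = 1" for x
    using cmod_cinner_le[of "S x" x] onorm[OF assms, of x] that by simp
  then have bdd: "bdd_above (insert 0 {cmod (cinner (S x) x) |x. norm x = 1})"
    by (auto intro!: bdd_aboveI[of _ "onorm S"])
  show "0 \<le> numerical_radius S"
    unfolding numerical_radius_def by (rule cSup_upper[OF _ bdd]) simp
  show "cmod (cinner (S x) x) \<le> numerical_radius S" if "norm x = 1"
    unfolding numerical_radius_def by (rule cSup_upper[OF _ bdd]) (use that in auto)
qed

lemma numerical_radius_le:
  fixes S :: "'a::chilbert_space \<Rightarrow> 'a"
  assumes "0 \<le> M" and "\<And>x. norm x = 1 \<Longrightarrow> cmod (cinner (S x) x) \<le> M"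
  shows "numerical_radius S \<le> M"
  unfolding numerical_radius_def by (rule cSup_least) (use assms in auto)

section \<open>Norm estimates for a positive operator\<close>

text \<open>With k the norm of \<open>X\<close>, the quadratic form of \<open>X\<close> is
  nonnegative at u - X u / k. In its expansion the term quadratic in 1/k costs at most
  \<open>norm (X u)\<close> squared over k, half of the cross term.\<close>

lemma positive_op_norm_power2_le:
  fixes X :: "'a::chilbert_space \<Rightarrow> 'a"
  assumes "positive_op X"
  shows "(norm (X u))\<^sup>2 \<le> onorm X * Re (cinner (X u) u)"
proof -
  note X = positive_opD(1,2)[OF assms] and sym = positive_opD(3)[OF assms]
    and pos = positive_opD(5)[OF assms]
  define k where "k = onorm X"
  show ?thesis
  proof (cases "k = 0")
    case True
    then show ?thesis using onorm[OF X(2), of u] by (simp add: k_def)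
  next
    case False
    then have k: "k > 0" using onorm_pos_le[OF X(2)] by (simp add: k_def)
    let ?v = "X u"
    let ?w = "u - (1/k) *\<^sub>R ?v"
    have Xw: "X ?w = ?v - (1/k) *\<^sub>R X ?v"
      by (simp add: linear_diff linear_scale bounded_linear.linear[OF X(2)])
    have symv: "cinner (X ?v) u = cinner ?v ?v"
      using cinner_cadjoint[OF X(1), of ?v u] by (simp add: sym)
    have "Re (cinner (X ?v) ?v) \<le> norm (X ?v) * norm ?v" by (rule Re_cinner_le)
    also have "\<dots> \<le> (k * norm ?v) * norm ?v"
      unfolding k_def by (intro mult_right_mono onorm X) simp
    finally have *: "Re (cinner (X ?v) ?v) / k\<^sup>2 \<le> (norm ?v)\<^sup>2 / k"
      using k by (simp add: field_simps power2_eq_square)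
    have "0 \<le> Re (cinner (X ?w) ?w)" by (rule pos)
    also have "\<dots> = Re (cinner ?v u) - 2 * (norm ?v)\<^sup>2 / k + Re (cinner (X ?v) ?v) / k\<^sup>2"
      unfolding Xw using k
      by (simp add: cinner_simps symv cinner_self power2_eq_square field_simps)
    also have "\<dots> \<le> Re (cinner ?v u) - (norm ?v)\<^sup>2 / k"
      using * by simp
    finally show ?thesis using k by (simp add: k_def field_simps)
  qed
qed

lemma positive_op_norm_diff_le:
  fixes X :: "'a::chilbert_space \<Rightarrow> 'a"
  assumes "positive_op X"
  shows "norm (X u - (of_real (onorm X) * l) *\<^sub>C u)
    \<le> onorm X * max (cmod l) (cmod (1 - l)) * norm u"
proof -
  note X = positive_opD(2)[OF assms]
  define k h M where "k = onorm X" and "h = Re (cinner (X u) u)"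
    and "M = max (cmod l) (cmod (1 - l))"
  have k: "0 \<le> k" by (simp add: k_def onorm_pos_le X)
  have h: "cinner (X u) u = of_real h" "0 \<le> h"
    unfolding h_def by (fact positive_opD[OF assms])+
  have hk: "h \<le> k * (norm u)\<^sup>2"
  proof -
    have "h \<le> norm (X u) * norm u" unfolding h_def by (rule Re_cinner_le)
    also have "\<dots> \<le> (k * norm u) * norm u"
      unfolding k_def by (intro mult_right_mono onorm X) simp
    finally show ?thesis by (simp add: power2_eq_square mult_ac)
  qed
  \<comment> \<open>The second left-hand side is the squared modulus of 1 - l, in the form in which
    it appears after expanding the norm.\<close>
  have M: "(cmod l)\<^sup>2 \<le> M\<^sup>2" "(cmod l)\<^sup>2 + 1 - 2 * Re l \<le> M\<^sup>2"
  proof -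
    show "(cmod l)\<^sup>2 \<le> M\<^sup>2" by (intro power_mono) (auto simp: M_def)
    have "(cmod (1 - l))\<^sup>2 \<le> M\<^sup>2" by (intro power_mono) (auto simp: M_def)
    moreover have "(cmod (1 - l))\<^sup>2 = (cmod l)\<^sup>2 + 1 - 2 * Re l"
      unfolding cmod_power2 by (simp add: power2_diff)
    ultimately show "(cmod l)\<^sup>2 + 1 - 2 * Re l \<le> M\<^sup>2" by simp
  qed
  have "(norm (X u - (of_real k * l) *\<^sub>C u))\<^sup>2
      = (norm (X u))\<^sup>2 - 2 * k * Re l * h + k\<^sup>2 * (cmod l)\<^sup>2 * (norm u)\<^sup>2"
    unfolding norm_diff_power2
    by (simp add: cinner_simps h norm_scaleC norm_mult power_mult_distrib k)
  also have "\<dots> \<le> k * h - 2 * k * Re l * h + k\<^sup>2 * (cmod l)\<^sup>2 * (norm u)\<^sup>2"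
    using positive_op_norm_power2_le[OF assms, of u] by (simp add: k_def h_def)
  \<comment> \<open>The affine function of \<open>h\<close> is rewritten through its endpoint
    values; both weights are nonnegative by \<open>h(2)\<close> and \<open>hk\<close>, so each value
    may be replaced by M^2.\<close>
  also have "\<dots> = k * (h * ((cmod l)\<^sup>2 + 1 - 2 * Re l) + (k * (norm u)\<^sup>2 - h) * (cmod l)\<^sup>2)"
    by (simp add: algebra_simps power2_eq_square)
  also have "\<dots> \<le> k * (h * M\<^sup>2 + (k * (norm u)\<^sup>2 - h) * M\<^sup>2)"
    using hk h k M by (intro mult_left_mono add_mono) auto
  also have "\<dots> = (k * M * norm u)\<^sup>2"
    by (simp add: algebra_simps power2_eq_square)
  finally have "norm (X u - (of_real k * l) *\<^sub>C u) \<le> k * M * norm u"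
    by (rule power2_le_imp_le) (use k in \<open>auto simp: M_def le_max_iff_disj\<close>)
  then show ?thesis by (simp add: k_def M_def)
qed

text \<open>Cauchy-Schwarz is spent only on the shifted part of \<open>X\<close>; the scalar part
  keeps \<open>cinner u v\<close>, which later becomes the quadratic form of
  \<open>A \<circ> B\<close>.\<close>

lemma positive_op_cmod_cinner_le:
  fixes X :: "'a::chilbert_space \<Rightarrow> 'a"
  assumes "positive_op X"
  shows "cmod (cinner (X u) v)
    \<le> onorm X * (max (cmod l) (cmod (1 - l)) * (norm u * norm v) + cmod l * cmod (cinner u v))"
proof -
  have k: "0 \<le> onorm X"
    by (rule onorm_pos_le[OF positive_opD(2)[OF assms]])
  let ?c = "of_real (onorm X) * l"
  have "cinner (X u) v = cinner (X u - ?c *\<^sub>C u) v + ?c * cinner u v"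
    by (simp add: cinner_simps)
  then have "cmod (cinner (X u) v)
      \<le> cmod (cinner (X u - ?c *\<^sub>C u) v) + cmod (?c * cinner u v)"
    by (metis norm_triangle_ineq)
  also have "\<dots> \<le> norm (X u - ?c *\<^sub>C u) * norm v + cmod (?c * cinner u v)"
    by (intro add_right_mono cmod_cinner_le)
  also have "\<dots> \<le> (onorm X * max (cmod l) (cmod (1 - l)) * norm u) * norm v
      + cmod (?c * cinner u v)"
    by (intro add_right_mono mult_right_mono positive_op_norm_diff_le assms) simp
  finally show ?thesis using k by (simp add: norm_mult algebra_simps)
qed

section \<open>Bounds for the product of the norms of \<open>cadjoint A x\<close> and
  \<open>B x\<close>\<close>

lemma norm_cadjoint_mult_norm_le_half_sum:
  fixes A B :: "'a::chilbert_space \<Rightarrow> 'a"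
  assumes A: "bounded_clinear A" and B: "bounded_clinear B" and x: "norm x = 1"
  shows "norm (cadjoint A x) * norm (B x)
    \<le> onorm (\<lambda>x. (abs_op (cadjoint A) ^^ 2) x + (abs_op B ^^ 2) x) / 2"
proof -
  let ?P = "\<lambda>x. A (cadjoint A x) + cadjoint B (B x)"
  have bl: "bounded_linear A" "bounded_linear B"
    "bounded_linear (cadjoint A)" "bounded_linear (cadjoint B)"
    using A B bounded_clinear_cadjoint[OF A] bounded_clinear_cadjoint[OF B]
    by (auto simp: bounded_clinear_def)
  have P: "bounded_linear ?P"
    by (intro bounded_linear_add bounded_linear_compose[OF bl(1)]
        bounded_linear_compose[OF bl(4)] bl)
  have "(norm (cadjoint A x))\<^sup>2 + (norm (B x))\<^sup>2 = Re (cinner (?P x) x)"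
    by (simp add: cinner_simps norm_power2_eq_cinner cinner_cadjoint[OF A]
        cinner_cadjoint_left[OF B])
  also have "\<dots> \<le> norm (?P x) * norm x" by (rule Re_cinner_le)
  also have "\<dots> \<le> onorm ?P" using onorm[OF P, of x] x by simp
  finally have "(norm (cadjoint A x))\<^sup>2 + (norm (B x))\<^sup>2 \<le> onorm ?P" .
  moreover have "2 * (norm (cadjoint A x) * norm (B x))
      \<le> (norm (cadjoint A x))\<^sup>2 + (norm (B x))\<^sup>2"
    using sum_squares_bound[of "norm (cadjoint A x)" "norm (B x)"] by simp
  moreover have "(\<lambda>x. (abs_op (cadjoint A) ^^ 2) x + (abs_op B ^^ 2) x) = ?P"
    by (simp add: abs_op_power2 A B bounded_clinear_cadjoint cadjoint_cadjoint)
  ultimately show ?thesis by simp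
qed

lemma norm_cadjoint_mult_norm_le_comp:
  fixes A B :: "'a::chilbert_space \<Rightarrow> 'a"
  assumes A: "bounded_clinear A" and B: "bounded_clinear B" and x: "norm x = 1"
  shows "norm (cadjoint A x) * norm (B x) \<le> (onorm A * onorm B + onorm (B \<circ> A)) / 2"
proof -
  have bl: "bounded_linear A" "bounded_linear B" "bounded_linear (B \<circ> A)"
    using A B bounded_linear_compose[of B A] by (auto simp: bounded_clinear_def comp_def)
  define \<alpha> \<beta> \<gamma> where "\<alpha> = onorm A" and "\<beta> = onorm B" and "\<gamma> = onorm (B \<circ> A)"
  define a b where "a = cadjoint A x" and "b = B x"
  have nonneg: "0 \<le> \<alpha>" "0 \<le> \<beta>" "0 \<le> \<gamma>"
    by (simp_all add: \<alpha>_def \<beta>_def \<gamma>_def onorm_pos_le bl)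
  have na: "norm a \<le> \<alpha>" and nb: "norm b \<le> \<beta>"
    using norm_cadjoint_le[OF A, of x] onorm[OF bl(2), of x] x
    by (simp_all add: a_def b_def \<alpha>_def \<beta>_def)
  have "norm a * norm b \<le> (\<alpha> * \<beta> + \<gamma>) / 2"
  \<comment> \<open>The balancing weights need both norms nonzero; otherwise the product on the left
    vanishes.\<close>
  proof (cases "\<alpha> = 0 \<or> \<beta> = 0")
    case True
    then have "norm a * norm b = 0" using na nb by auto
    moreover have "0 \<le> (\<alpha> * \<beta> + \<gamma>) / 2" using nonneg by simp
    ultimately show ?thesis by linarith
  next
    case False
    text \<open>Balancing \<open>A\<close> and \<open>B\<close> by the weights \<open>p = \<beta>/\<alpha>\<close> and \<open>q = \<alpha>/\<beta>\<close> corresponds to rescaling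
      them to equal norm.\<close>
    define p q where "p = \<beta> / \<alpha>" and "q = \<alpha> / \<beta>"
    have pq: "p * q = 1" "p * \<alpha> = \<beta>" "q * \<beta> = \<alpha>" "p > 0" "q > 0"
      using False nonneg by (auto simp: p_def q_def)
    define s where "s = p * (norm a)\<^sup>2 + q * (norm b)\<^sup>2"
    define w where "w = p *\<^sub>R A a + q *\<^sub>R cadjoint B b"
    have amgm: "2 * (norm a * norm b) \<le> s"
    proof -
      \<comment> \<open>Weighted AM-GM: with p q = 1 the weights cancel in the cross term.\<close>
      have "0 \<le> p * (norm a - q * norm b)\<^sup>2" using pq by simp
      also have "\<dots> = s - 2 * (p * q) * (norm a * norm b) + (p * q - 1) * (q * (norm b)\<^sup>2)"
        by (simp add: s_def algebra_simps power2_eq_square)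
      finally show ?thesis using pq(1) by simp
    qed
    have "s = Re (cinner w x)"
      by (simp add: s_def w_def cinner_simps norm_power2_eq_cinner cinner_cadjoint[OF A]
          cinner_cadjoint_left[OF B] flip: a_def b_def)
    also have "\<dots> \<le> norm w" using Re_cinner_le[of w x] x by simp
    finally have sw: "s \<le> norm w" .
    \<comment> \<open>Moving \<open>cadjoint B\<close> across the cross term of the squared norm of
      \<open>w\<close> is what brings in the norm of \<open>B \<circ> A\<close>.\<close>
    have "Re (cinner (A a) (cadjoint B b)) = Re (cinner ((B \<circ> A) a) b)"
      by (simp add: cinner_cadjoint[OF B])
    also have "\<dots> \<le> norm ((B \<circ> A) a) * norm b" by (rule Re_cinner_le)
    also have "\<dots> \<le> (\<gamma> * norm a) * norm b"
      unfolding \<gamma>_def by (intro mult_right_mono onorm bl) simp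
    finally have cross: "Re (cinner (A a) (cadjoint B b)) \<le> \<gamma> * (norm a * norm b)"
      by (simp add: mult_ac)
    have "(norm (A a))\<^sup>2 \<le> (\<alpha> * norm a)\<^sup>2" "(norm (cadjoint B b))\<^sup>2 \<le> (\<beta> * norm b)\<^sup>2"
      unfolding \<alpha>_def \<beta>_def by (intro power_mono onorm bl norm_cadjoint_le B norm_ge_zero)+
    then have sq: "p\<^sup>2 * (norm (A a))\<^sup>2 \<le> p\<^sup>2 * (\<alpha> * norm a)\<^sup>2"
      "q\<^sup>2 * (norm (cadjoint B b))\<^sup>2 \<le> q\<^sup>2 * (\<beta> * norm b)\<^sup>2"
      by (auto intro: mult_left_mono)
    have "(norm w)\<^sup>2 = p\<^sup>2 * (norm (A a))\<^sup>2
        + 2 * ((p * q) * Re (cinner (A a) (cadjoint B b))) + q\<^sup>2 * (norm (cadjoint B b))\<^sup>2"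
      unfolding w_def norm_add_power2
      by (simp add: cinner_simps power_mult_distrib mult_ac)
    also have "\<dots> \<le> p\<^sup>2 * (\<alpha> * norm a)\<^sup>2 + \<gamma> * (2 * (norm a * norm b)) + q\<^sup>2 * (\<beta> * norm b)\<^sup>2"
      using sq cross pq(1) by simp
    also have "\<dots> \<le> p\<^sup>2 * (\<alpha> * norm a)\<^sup>2 + \<gamma> * s + q\<^sup>2 * (\<beta> * norm b)\<^sup>2"
      by (intro add_mono mult_left_mono amgm nonneg order_refl)
    \<comment> \<open>Grouped so that \<open>p * \<alpha> = \<beta>\<close> and
      \<open>q * \<beta> = \<alpha>\<close> give both squares the common factor \<alpha> \<beta>,
      leaving a multiple of \<open>s\<close>.\<close>
    also have "\<dots> = (p * \<alpha>) * \<alpha> * p * (norm a)\<^sup>2 + \<gamma> * s + (q * \<beta>) * \<beta> * q * (norm b)\<^sup>2"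
      by (simp add: power2_eq_square mult_ac)
    also have "\<dots> = (\<alpha> * \<beta> + \<gamma>) * s"
      unfolding pq s_def by (simp add: algebra_simps)
    finally have "(norm w)\<^sup>2 \<le> (\<alpha> * \<beta> + \<gamma>) * s" .
    moreover have s0: "0 \<le> s" using pq by (simp add: s_def)
    ultimately have "s * s \<le> (\<alpha> * \<beta> + \<gamma>) * s"
      using sw power_mono[OF sw s0, of 2] by (simp add: power2_eq_square)
    then have "s \<le> \<alpha> * \<beta> + \<gamma>"
      using s0 nonneg by (cases "s = 0") auto
    with amgm show ?thesis by simp
  qed
  then show ?thesis by (simp add: \<alpha>_def \<beta>_def \<gamma>_def a_def b_def)
qed

section \<open>The numerical radius inequalities\<close>

text \<open>The two inequalities of the theorem differ only in how the product of norms is bounded,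
  so that bound is kept as a parameter \<open>N\<close>.\<close>

lemma numerical_radius_comp_positive_le:
  fixes A X B :: "'a::chilbert_space \<Rightarrow> 'a"
  assumes A: "bounded_clinear A" and B: "bounded_clinear B" and X: "positive_op X"
    and "0 \<le> N" and N: "\<And>x. norm x = 1 \<Longrightarrow> norm (cadjoint A x) * norm (B x) \<le> N"
  shows "numerical_radius (A \<circ> X \<circ> B)
    \<le> onorm X * (max (cmod l) (cmod (1 - l)) * N + cmod l * numerical_radius (A \<circ> B))"
proof (rule numerical_radius_le)
  have bl: "bounded_linear (A \<circ> B)"
    using A B bounded_linear_compose[of A B] by (auto simp: bounded_clinear_def comp_def)
  have k: "0 \<le> onorm X"
    by (rule onorm_pos_le[OF positive_opD(2)[OF X]])
  have M: "0 \<le> max (cmod l) (cmod (1 - l))" by (simp add: le_max_iff_disj)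
  show "0 \<le> onorm X * (max (cmod l) (cmod (1 - l)) * N + cmod l * numerical_radius (A \<circ> B))"
    using k M \<open>0 \<le> N\<close> numerical_radius_nonneg[OF bl] by simp
  fix x :: 'a assume x: "norm x = 1"
  have "cmod (cinner ((A \<circ> X \<circ> B) x) x) = cmod (cinner (X (B x)) (cadjoint A x))"
    by (simp add: cinner_cadjoint[OF A])
  also have "\<dots> \<le> onorm X * (max (cmod l) (cmod (1 - l)) * (norm (B x) * norm (cadjoint A x))
      + cmod l * cmod (cinner (B x) (cadjoint A x)))"
    by (rule positive_op_cmod_cinner_le[OF X])
  also have "cinner (B x) (cadjoint A x) = cinner ((A \<circ> B) x) x"
    by (simp add: cinner_cadjoint[OF A])
  also have "onorm X * (max (cmod l) (cmod (1 - l)) * (norm (B x) * norm (cadjoint A x))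
      + cmod l * cmod (cinner ((A \<circ> B) x) x))
    \<le> onorm X * (max (cmod l) (cmod (1 - l)) * N + cmod l * numerical_radius (A \<circ> B))"
    using N[OF x] numerical_radius_upper[OF bl x]
    by (intro mult_left_mono add_mono k M) (auto simp: mult.commute)
  finally show "cmod (cinner ((A \<circ> X \<circ> B) x) x)
    \<le> onorm X * (max (cmod l) (cmod (1 - l)) * N + cmod l * numerical_radius (A \<circ> B))" .
qed

theorem theorem4:
  fixes A X B :: "'a::chilbert_space \<Rightarrow> 'a" and l :: complex
  assumes "bounded_clinear A" and "bounded_clinear X" and "bounded_clinear B"
    and "positive_op X"
  shows "numerical_radius (A \<circ> X \<circ> B) \<le>
      onorm X * (max (cmod l) (cmod (1 - l)) / 2
          * onorm (\<lambda>x. (abs_op (cadjoint A) ^^ 2) x + (abs_op B ^^ 2) x)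
        + cmod l * numerical_radius (A \<circ> B))
    \<and> numerical_radius (A \<circ> X \<circ> B) \<le>
      onorm X * (cmod l * numerical_radius (A \<circ> B)
        + max (cmod l) (cmod (1 - l)) / 2 * (onorm A * onorm B + onorm (B \<circ> A)))"
proof
  note A = assms(1) and B = assms(3)
  have bl: "bounded_linear A" "bounded_linear B"
    "bounded_linear (cadjoint A)" "bounded_linear (cadjoint B)"
    using A B bounded_clinear_cadjoint[OF A] bounded_clinear_cadjoint[OF B]
    by (auto simp: bounded_clinear_def)
  let ?P = "\<lambda>x. (abs_op (cadjoint A) ^^ 2) x + (abs_op B ^^ 2) x"
  have "?P = (\<lambda>x. A (cadjoint A x) + cadjoint B (B x))"
    by (simp add: abs_op_power2 A B bounded_clinear_cadjoint cadjoint_cadjoint)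
  \<comment> \<open>Bounded linearity, which makes \<open>onorm ?P\<close> nonnegative, is read off
    from the form of \<open>?P\<close> without absolute values.\<close>
  moreover have "bounded_linear (\<lambda>x. A (cadjoint A x) + cadjoint B (B x))"
    by (intro bounded_linear_add bounded_linear_compose[OF bl(1)]
        bounded_linear_compose[OF bl(4)] bl)
  ultimately have "0 \<le> onorm ?P / 2" by (simp add: onorm_pos_le)
  from numerical_radius_comp_positive_le[OF A B assms(4) this
      norm_cadjoint_mult_norm_le_half_sum[OF A B]]
  show "numerical_radius (A \<circ> X \<circ> B) \<le>
      onorm X * (max (cmod l) (cmod (1 - l)) / 2 * onorm ?P
        + cmod l * numerical_radius (A \<circ> B))"
    by simp
  have "bounded_linear (B \<circ> A)"
    using bounded_linear_compose[OF bl(2) bl(1)] by (simp add: comp_def)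
  then have "0 \<le> (onorm A * onorm B + onorm (B \<circ> A)) / 2"
    by (simp add: onorm_pos_le bl)
  from numerical_radius_comp_positive_le[OF A B assms(4) this
      norm_cadjoint_mult_norm_le_comp[OF A B]]
  show "numerical_radius (A \<circ> X \<circ> B) \<le>
      onorm X * (cmod l * numerical_radius (A \<circ> B)
        + max (cmod l) (cmod (1 - l)) / 2 * (onorm A * onorm B + onorm (B \<circ> A)))"
    by (simp add: add.commute)
qed

end
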